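(* Let $F$ be a field, let $R$ be a finite-dimensional associative $F$-algebra with non-trivial center, and let $V\subseteq R$ be a vector subspace which generates $R$ as an algebra. Let $\dim R=d$, $\dim V=m$, and let $c(x_1,\ldots,x_n)\in F\langle X\rangle$ be a multilinear (non-trivial) central polynomial for $R$. Fix a basis $U=\{u_1,\ldots,u_m\}$ of $V$. For every $n$-tuple $h=(h_1,\ldots,h_n)$ of integers with $1\le h_p\le d-m+1$, $p=1,\ldots,n$, put \[ c'_h(Y)=c(y_{11}\cdots y_{1h_1},\ldots,y_{n1}\cdots y_{nh_n})\in F\langle Y\rangle . \] Then there exist such an $n$-tuple $h$ and elements $u_{i_{pj}}\in U$, $j=1,\ldots,h_p$, $p=1,\ldots,n$, such that \[ c(u_{i_{11}}\cdots u_{i_{1h_1}},\ldots,u_{i_{n1}}\cdots u_{i_{nh_n}})\neq 0, \] and for any such $h$ the polynomial $c'_h(Y)$ is a non-trivial central polynomial for the pair $(R,V)$. (Hence evaluating the finitely many $c'_h$ on all the finitely many collections of elements of $U$ finds a non-trivial central polynomial for $(R,V)$.)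
   Context: $F\langle X\rangle=F\langle x_1,x_2,\ldots\rangle$ and $F\langle Y\rangle$ denote free associative algebras over $F$, where $Y=\{y_{ij}\}$ is another set of free variables. A polynomial $f(x_1,\ldots,x_n)$ is an identity for the pair $(R,V)$ if $f(v_1,\ldots,v_n)=0$ for all $v_1,\ldots,v_n\in V$. A polynomial $c(x_1,\ldots,x_n)$ is a (non-trivial, or essential) central polynomial for the pair $(R,V)$ if $c(v_1,\ldots,v_n)$ belongs to the center of $R$ for all $v_1,\ldots,v_n\in V$ and $c$ is not an identity for $(R,V)$. A (non-trivial) central polynomial of the algebra $R$ is a central polynomial for the pair $(R,R)$. Multilinear means linear in each of the variables $x_1,\ldots,x_n$. *)

theory Defs
  imports Complex_Main "HOL-Library.Poly_Mapping"
begin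

locale assoc_algebra = vector_space scale
  for scale :: "'f::field \<Rightarrow> 'r::ring \<Rightarrow> 'r" +
  assumes scale_mult_left: "scale a x * y = scale a (x * y)"
    and scale_mult_right: "x * scale a y = scale a (x * y)"

text \<open>The library's \<open>finite_dimensional_vector_space\<close> carries a distinguished basis as a
  locale parameter; here only its existence is required.\<close>

locale fd_assoc_algebra = assoc_algebra +
  assumes finite_dim: "\<exists>B. finite B \<and> span B = UNIV"

definition center :: "'r::ring set" where
  "center = {z. \<forall>x. z * x = x * z}"

definition subalgebra :: "('f::field \<Rightarrow> 'r::ring \<Rightarrow> 'r) \<Rightarrow> 'r set \<Rightarrow> bool" where
  "subalgebra scale S \<longleftrightarrow> module.subspace scale S \<and> (\<forall>x\<in>S. \<forall>y\<in>S. x * y \<in> S)"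

text \<open>Generation is as an algebra without unit: the empty product is not available.\<close>

definition generates :: "('f::field \<Rightarrow> 'r::ring \<Rightarrow> 'r) \<Rightarrow> 'r set \<Rightarrow> bool" where
  "generates scale V \<longleftrightarrow> subalgebra scale hull V = UNIV"

text \<open>Product of a nonempty word. The value on the empty word is a dummy and is never used,
  since all polynomials below have zero constant term.\<close>

fun word_prod :: "'r::ring list \<Rightarrow> 'r" where
  "word_prod [] = 0"
| "word_prod [x] = x"
| "word_prod (x # y # zs) = x * word_prod (y # zs)"


text \<open>Words form the free monoid under concatenation, so that the convolution product of
  \<^theory>\<open>HOL-Library.Poly_Mapping\<close> makes \<open>'x list \<Rightarrow>\<^sub>0 'f\<close> the free associative
  unital algebra on \<open>'x\<close>.\<close>

instantiation list :: (type) monoid_add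
begin

definition zero_list :: "'a list" where "zero_list = []"
definition plus_list :: "'a list \<Rightarrow> 'a list \<Rightarrow> 'a list" where "plus_list u v = u @ v"

instance by standard (simp_all add: zero_list_def plus_list_def)

end

type_synonym ('x, 'f) nc_poly = "'x list \<Rightarrow>\<^sub>0 'f"

definition Var :: "'x \<Rightarrow> ('x, 'f::field) nc_poly" where
  "Var x = Poly_Mapping.single [x] 1"

definition poly_scale :: "'f::field \<Rightarrow> ('x, 'f) nc_poly \<Rightarrow> ('x, 'f) nc_poly" where
  "poly_scale a p = Poly_Mapping.map ((*) a) p"

text \<open>Algebras need not have a unit, so the polynomials that can be evaluated in them are those
  of the free algebra without unit, that is, those with zero constant term.\<close>

definition free_algebra :: "('x, 'f::field) nc_poly set" where
  "free_algebra = {p. Poly_Mapping.lookup p [] = 0}"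

text \<open>The algebra homomorphism on \<open>free_algebra\<close> that sends each variable \<open>x\<close> to \<open>\<rho> x\<close>.\<close>

definition nc_eval ::
  "('f::field \<Rightarrow> 'r::ring \<Rightarrow> 'r) \<Rightarrow> ('x \<Rightarrow> 'r) \<Rightarrow> ('x, 'f) nc_poly \<Rightarrow> 'r" where
  "nc_eval scale \<rho> p =
     (\<Sum>w\<in>Poly_Mapping.keys p. scale (Poly_Mapping.lookup p w) (word_prod (map \<rho> w)))"

text \<open>Linearity in a variable is formal: every monomial has degree one in it, and no variables
  other than \<open>x\<^sub>1, \<dots>, x\<^sub>n\<close> occur. The variable with index \<open>0\<close> is not used.\<close>

definition multilinear :: "nat \<Rightarrow> (nat, 'f::field) nc_poly \<Rightarrow> bool" where
  "multilinear n c \<longleftrightarrow>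
     (\<forall>w\<in>Poly_Mapping.keys c. set w \<subseteq> {1..n} \<and> (\<forall>p\<in>{1..n}. count_list w p = 1))"


text \<open>All variables, not only those occurring in \<open>f\<close>, are assigned values in \<open>V\<close>; as \<open>V\<close> is nonempty
  this makes no difference.\<close>

definition pair_identity ::
  "('f::field \<Rightarrow> 'r::ring \<Rightarrow> 'r) \<Rightarrow> 'r set \<Rightarrow> ('x, 'f) nc_poly \<Rightarrow> bool" where
  "pair_identity scale V f \<longleftrightarrow>
     f \<in> free_algebra \<and> (\<forall>v. (\<forall>x. v x \<in> V) \<longrightarrow> nc_eval scale v f = 0)"

definition pair_central_poly ::
  "('f::field \<Rightarrow> 'r::ring \<Rightarrow> 'r) \<Rightarrow> 'r set \<Rightarrow> ('x, 'f) nc_poly \<Rightarrow> bool" where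
  "pair_central_poly scale V c \<longleftrightarrow>
     c \<in> free_algebra \<and> (\<forall>v. (\<forall>x. v x \<in> V) \<longrightarrow> nc_eval scale v c \<in> center) \<and>
     \<not> pair_identity scale V c"

abbreviation central_poly ::
  "('f::field \<Rightarrow> 'r::ring \<Rightarrow> 'r) \<Rightarrow> ('x, 'f) nc_poly \<Rightarrow> bool" where
  "central_poly scale \<equiv> pair_central_poly scale UNIV"

text \<open>\<open>c(y\<^sub>1\<^sub>1\<cdots>y\<^sub>1\<^sub>h\<^sub>1, \<dots>, y\<^sub>n\<^sub>1\<cdots>y\<^sub>n\<^sub>h\<^sub>n)\<close>, with \<open>y\<^sub>p\<^sub>j\<close> the variable indexed by \<open>(p, j)\<close>.\<close>

definition word_subst ::
  "(nat, 'f::field) nc_poly \<Rightarrow> (nat \<Rightarrow> nat) \<Rightarrow> (nat \<times> nat, 'f) nc_poly" where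
  "word_subst c h = nc_eval poly_scale (\<lambda>p. word_prod (map (\<lambda>j. Var (p, j)) [1..<h p + 1])) c"


definition nonzero_on_words ::
  "('f::field \<Rightarrow> 'r::ring \<Rightarrow> 'r) \<Rightarrow> (nat \<Rightarrow> 'r) \<Rightarrow> nat \<Rightarrow> nat \<Rightarrow> (nat, 'f) nc_poly \<Rightarrow> (nat \<Rightarrow> nat) \<Rightarrow> bool" where
  "nonzero_on_words scale u m n c h \<longleftrightarrow>
     (\<exists>i. (\<forall>p\<in>{1..n}. \<forall>j\<in>{1..h p}. i p j \<in> {1..m}) \<and>
          nc_eval scale (\<lambda>p. word_prod (map (\<lambda>j. u (i p j)) [1..<h p + 1])) c \<noteq> 0)"


lemma lookup_poly_scale: "Poly_Mapping.lookup (poly_scale a p) w = a * Poly_Mapping.lookup p w"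
  by (simp add: poly_scale_def Poly_Mapping.map.rep_eq when_def)

lemma poly_scale_eq_mult: "poly_scale a p = Poly_Mapping.single 0 a * p"
  unfolding poly_scale_def by (simp add: mult_map_scale_conv_mult)

lemma poly_scale_eq_mult_right: "poly_scale a p = p * Poly_Mapping.single 0 a"
proof (induction p rule: update_induct)
  case const
  show ?case by (simp add: poly_scale_eq_mult)
next
  case (update p w b)
  have upd: "Poly_Mapping.update w b p = Poly_Mapping.single w b + p"
    using update.hyps(1)
    by (intro poly_mapping_eqI)
      (auto simp: lookup_update lookup_add lookup_single in_keys_iff when_def)
  have "poly_scale a (Poly_Mapping.single w b) = Poly_Mapping.single w b * Poly_Mapping.single 0 a"
    by (simp add: poly_scale_eq_mult mult_single mult.commute)
  with update.IH show ?case
    by (simp add: upd poly_scale_eq_mult distrib_left distrib_right)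
qed

lemma assoc_algebra_poly_scale:
  "assoc_algebra (poly_scale :: 'f::field \<Rightarrow> ('x, 'f) nc_poly \<Rightarrow> ('x, 'f) nc_poly)"
proof
  fix a b :: 'f and p q :: "('x, 'f) nc_poly"
  show "poly_scale a (p + q) = poly_scale a p + poly_scale a q"
    by (rule poly_mapping_eqI) (simp add: lookup_poly_scale lookup_add distrib_left)
  show "poly_scale (a + b) p = poly_scale a p + poly_scale b p"
    by (rule poly_mapping_eqI) (simp add: lookup_poly_scale lookup_add distrib_right)
  show "poly_scale a (poly_scale b p) = poly_scale (a * b) p"
    by (rule poly_mapping_eqI) (simp add: lookup_poly_scale mult.assoc)
  show "poly_scale 1 p = p"
    by (rule poly_mapping_eqI) (simp add: lookup_poly_scale)
  show "poly_scale a p * q = poly_scale a (p * q)"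
    by (simp add: poly_scale_eq_mult mult.assoc)
  show "p * poly_scale a q = poly_scale a (p * q)"
    by (simp add: poly_scale_eq_mult_right mult.assoc)
qed

end

theory Submission
  imports Defs
begin

text \<open>Let \<open>S k\<close> be the span of the words of length at most \<open>k\<close> in the basis of \<open>V\<close>. If
  \<open>S k = S (k + 1)\<close> for some \<open>k \<ge> 1\<close>, then \<open>S k\<close> is a subalgebra containing \<open>V\<close>, hence all of \<open>R\<close>;
  so the dimension grows by at least one at each step until \<open>R\<close> is reached, which takes at most
  \<open>d - m + 1\<close> steps. A multilinear polynomial that vanishes on a spanning set is an identity,
  so \<open>c\<close> is nonzero on some choice of these words. Conversely, the values of \<open>c'\<^sub>h\<close> on \<open>V\<close> are
  values of \<open>c\<close> on \<open>R\<close>, hence central.\<close>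

section \<open>Products of words and their dependence on one letter\<close>

lemma word_prod_Cons: "xs \<noteq> [] \<Longrightarrow> word_prod (x # xs) = x * word_prod xs"
  by (cases xs) auto

lemma word_prod_append:
  "xs \<noteq> [] \<Longrightarrow> ys \<noteq> [] \<Longrightarrow> word_prod (xs @ ys) = word_prod xs * word_prod ys"
  by (induction xs rule: word_prod.induct) (auto simp: word_prod_Cons mult.assoc)

lemma word_prod_concat:
  "\<forall>xs\<in>set xss. xs \<noteq> [] \<Longrightarrow> word_prod (concat xss) = word_prod (map word_prod xss)"
proof (induction xss)
  case (Cons xs xss)
  then show ?case
    by (cases xss) (auto simp: word_prod_append)
qed simp

lemma word_prod_add:
  "word_prod (xs @ (a + b) # ys) = word_prod (xs @ a # ys) + word_prod (xs @ b # ys)"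
proof (induction xs)
  case Nil
  show ?case by (cases ys) (auto simp: distrib_right)
qed (simp add: word_prod_Cons distrib_left)

text \<open>Since \<open>p\<close> occurs exactly once in \<open>w\<close>, the words around it do
  not involve the value at \<open>p\<close>. The same \<open>xs\<close> and \<open>ys\<close> thus
  serve every \<open>a\<close>, which reduces linearity of a polynomial in \<open>p\<close> to
  linearity of a product in one factor.\<close>

lemma map_upd_split:
  assumes "count_list w p = 1"
  shows "\<exists>xs ys. \<forall>a. map (\<rho>(p := a)) w = xs @ a # ys"
proof -
  from assms have "p \<in> set w" by (metis count_notin zero_neq_one)
  then obtain xs ys where w: "w = xs @ p # ys" by (meson split_list)
  with assms have "p \<notin> set xs" "p \<notin> set ys" by (auto simp: count_list_0_iff)
  then show ?thesis
    by (intro exI[of _ "map \<rho> xs"] exI[of _ "map \<rho> ys"]) (simp add: w)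
qed

section \<open>Substituting blocks of fresh letters\<close>

lemma word_prod_Var: "w \<noteq> [] \<Longrightarrow> word_prod (map Var w) = Poly_Mapping.single w 1"
proof (induction w)
  case (Cons x w)
  then show ?case
    by (cases w) (auto simp: Var_def mult_single plus_list_def)
qed simp

lemma multilinear_nc_eval_cong:
  assumes c: "multilinear n c" and eq: "\<And>p. p \<in> {1..n} \<Longrightarrow> \<rho> p = \<sigma> p"
  shows "nc_eval scale \<rho> c = nc_eval scale \<sigma> c"
  unfolding nc_eval_def
proof (intro sum.cong refl)
  fix w assume "w \<in> Poly_Mapping.keys c"
  with c have "set w \<subseteq> {1..n}" by (auto simp: multilinear_def)
  with eq have "map \<rho> w = map \<sigma> w" by (auto intro: map_cong)
  then show "scale (Poly_Mapping.lookup c w) (word_prod (map \<rho> w))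
      = scale (Poly_Mapping.lookup c w) (word_prod (map \<sigma> w))" by (simp only:)
qed

text \<open>Substitution turns a monomial into a monomial, each letter \<open>p\<close> becoming the
  block of letters \<open>(p, 1), ..., (p, h p)\<close>. As \<open>h p\<close> is positive, all
  blocks are nonempty and the dummy value of \<open>word_prod\<close> on \<open>[]\<close> never
  enters.\<close>

lemma word_subst_eq_sum:
  fixes c :: "(nat, 'f::field) nc_poly"
  assumes c: "multilinear n c" and c_free: "c \<in> free_algebra" and h: "\<forall>p\<in>{1..n}. 1 \<le> h p"
  shows "word_subst c h = (\<Sum>w\<in>Poly_Mapping.keys c.
    Poly_Mapping.single (concat (map (\<lambda>p. map (Pair p) [1..<h p + 1]) w)) (Poly_Mapping.lookup c w))"
  unfolding word_subst_def nc_eval_def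
proof (intro sum.cong refl)
  fix w assume w: "w \<in> Poly_Mapping.keys c"
  have ws: "set w \<subseteq> {1..n}" using w c by (auto simp: multilinear_def)
  have "w \<noteq> []" using w c_free by (auto simp: free_algebra_def in_keys_iff)
  let ?b = "\<lambda>p. map (Pair p) [1..<h p + 1]"
  have b: "?b p \<noteq> []" if "p \<in> set w" for p using ws that h by (auto simp: Suc_le_eq)
  then have ne: "concat (map ?b w) \<noteq> []" using \<open>w \<noteq> []\<close> by (cases w) auto
  have "word_prod (map (\<lambda>p. word_prod (map (\<lambda>j. Var (p, j)) [1..<h p + 1])) w)
      = (word_prod (map Var (concat (map ?b w))) :: (nat \<times> nat, 'f) nc_poly)"
    using b by (simp add: map_concat word_prod_concat comp_def del: upt_Suc)
  also have "\<dots> = Poly_Mapping.single (concat (map ?b w)) 1"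
    using ne by (rule word_prod_Var)
  finally show "poly_scale (Poly_Mapping.lookup c w)
      (word_prod (map (\<lambda>p. word_prod (map (\<lambda>j. Var (p, j)) [1..<h p + 1])) w))
      = Poly_Mapping.single (concat (map ?b w)) (Poly_Mapping.lookup c w)"
    by (simp add: poly_scale_eq_mult mult_single)
qed

lemma word_subst_in_free_algebra:
  assumes "multilinear n c" "c \<in> free_algebra" "\<forall>p\<in>{1..n}. 1 \<le> h p"
  shows "word_subst c h \<in> free_algebra"
proof -
  have "concat (map (\<lambda>p. map (Pair p) [1..<h p + 1]) w) \<noteq> []"
    if w: "w \<in> Poly_Mapping.keys c" for w
  proof -
    have "w \<noteq> []" "set w \<subseteq> {1..n}"
      using w assms by (auto simp: free_algebra_def in_keys_iff multilinear_def)
    then show ?thesis using assms(3) by (cases w) (auto simp: Suc_le_eq)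
  qed
  then show ?thesis
    unfolding word_subst_eq_sum[OF assms]
    by (auto simp: free_algebra_def lookup_sum lookup_single when_def
        simp del: concat_eq_Nil_conv intro!: sum.neutral)
qed

section \<open>Products of words of bounded length\<close>

definition words_upto :: "'r::ring set \<Rightarrow> nat \<Rightarrow> 'r set" where
  "words_upto U k = word_prod ` {xs. set xs \<subseteq> U \<and> 1 \<le> length xs \<and> length xs \<le> k}"

lemma words_upto_mono: "k \<le> l \<Longrightarrow> words_upto U k \<subseteq> words_upto U l"
  by (auto simp: words_upto_def)

lemma words_upto_one: "words_upto U (Suc 0) = U"
proof -
  have "{xs. set xs \<subseteq> U \<and> 1 \<le> length xs \<and> length xs \<le> Suc 0} = (\<lambda>a. [a]) ` U"
    by (auto simp: le_Suc_eq length_Suc_conv)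
  then show ?thesis by (simp only: words_upto_def image_image word_prod.simps image_ident)
qed

section \<open>Evaluation in an algebra\<close>

context assoc_algebra
begin

lemma word_prod_scale: "word_prod (xs @ scale r a # ys) = scale r (word_prod (xs @ a # ys))"
proof (induction xs)
  case Nil
  show ?case by (cases ys) (auto simp: scale_mult_left)
qed (simp add: word_prod_Cons scale_mult_right)

text \<open>Words outside the support contribute zero. A larger index set allows \<open>p\<close>,
  \<open>q\<close> and \<open>p + q\<close> to be summed over the same words, although cancellation
  may shrink the support of \<open>p + q\<close>.\<close>

lemma nc_eval_eq_sum:
  assumes "finite A" "Poly_Mapping.keys p \<subseteq> A"
  shows "nc_eval scale \<rho> p = (\<Sum>w\<in>A. scale (Poly_Mapping.lookup p w) (word_prod (map \<rho> w)))"
  unfolding nc_eval_def using assms by (intro sum.mono_neutral_left) (auto simp: in_keys_iff)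

lemma nc_eval_add: "nc_eval scale \<rho> (p + q) = nc_eval scale \<rho> p + nc_eval scale \<rho> q"
proof -
  let ?A = "Poly_Mapping.keys p \<union> Poly_Mapping.keys q"
  show ?thesis
    using Poly_Mapping.keys_add[of p q]
    by (simp add: nc_eval_eq_sum[of ?A] lookup_add scale_left_distrib sum.distrib)
qed

lemma nc_eval_sum: "nc_eval scale \<rho> (sum f A) = (\<Sum>a\<in>A. nc_eval scale \<rho> (f a))"
  by (induction A rule: infinite_finite_induct) (simp_all add: nc_eval_add, simp_all add: nc_eval_def)

lemma nc_eval_single:
  "nc_eval scale \<rho> (Poly_Mapping.single w a) = scale a (word_prod (map \<rho> w))"
  by (simp add: nc_eval_def)

text \<open>Monomial by monomial, the product over a concatenation is the product of the block
  products. This identifies values of the substituted polynomial with values of \<open>c\<close>,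
  both for centrality and for non-vanishing.\<close>

lemma nc_eval_word_subst:
  assumes "multilinear n c" "c \<in> free_algebra" "\<forall>p\<in>{1..n}. 1 \<le> h p"
  shows "nc_eval scale v (word_subst c h)
    = nc_eval scale (\<lambda>p. word_prod (map (\<lambda>j. v (p, j)) [1..<h p + 1])) c"
  unfolding word_subst_eq_sum[OF assms] nc_eval_sum nc_eval_single nc_eval_def[of scale _ c]
proof (intro sum.cong refl arg_cong2[where f = scale])
  fix w assume w: "w \<in> Poly_Mapping.keys c"
  have "map (\<lambda>j. v (p, j)) [1..<h p + 1] \<noteq> []" if "p \<in> set w" for p
    using assms(1,3) w that by (force simp: multilinear_def)
  then show "word_prod (map v (concat (map (\<lambda>p. map (Pair p) [1..<h p + 1]) w)))
      = word_prod (map (\<lambda>p. word_prod (map (\<lambda>j. v (p, j)) [1..<h p + 1])) w)"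
    by (simp add: map_concat word_prod_concat comp_def del: upt_Suc)
qed

lemma nc_eval_upd_add:
  assumes "multilinear n c" "p \<in> {1..n}"
  shows "nc_eval scale (\<rho>(p := a + b)) c
    = nc_eval scale (\<rho>(p := a)) c + nc_eval scale (\<rho>(p := b)) c"
proof -
  have "word_prod (map (\<rho>(p := a + b)) w)
      = word_prod (map (\<rho>(p := a)) w) + word_prod (map (\<rho>(p := b)) w)"
    if "w \<in> Poly_Mapping.keys c" for w
  proof -
    have "count_list w p = 1" using assms that by (auto simp: multilinear_def)
    then obtain xs ys where split: "\<And>a. map (\<rho>(p := a)) w = xs @ a # ys"
      using map_upd_split by metis
    show ?thesis unfolding split by (rule word_prod_add)
  qed
  then show ?thesis
    unfolding nc_eval_def sum.distrib[symmetric]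
    by (intro sum.cong refl) (simp only: scale_right_distrib)
qed

lemma nc_eval_upd_scale:
  assumes "multilinear n c" "p \<in> {1..n}"
  shows "nc_eval scale (\<rho>(p := scale r a)) c = scale r (nc_eval scale (\<rho>(p := a)) c)"
proof -
  have "word_prod (map (\<rho>(p := scale r a)) w) = scale r (word_prod (map (\<rho>(p := a)) w))"
    if "w \<in> Poly_Mapping.keys c" for w
  proof -
    have "count_list w p = 1" using assms that by (auto simp: multilinear_def)
    then obtain xs ys where split: "\<And>a. map (\<rho>(p := a)) w = xs @ a # ys"
      using map_upd_split by metis
    show ?thesis unfolding split by (rule word_prod_scale)
  qed
  then show ?thesis
    unfolding nc_eval_def scale_sum_right
    by (intro sum.cong refl) (simp only: scale_left_commute[of r])
qed

lemma nc_eval_upd_zero_on_span: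
  assumes c: "multilinear n c" "p \<in> {1..n}"
    and W: "\<And>a. a \<in> W \<Longrightarrow> nc_eval scale (\<rho>(p := a)) c = 0" and x: "x \<in> span W"
  shows "nc_eval scale (\<rho>(p := x)) c = 0"
proof -
  \<comment> \<open>Homogeneity with scalar 0.\<close>
  have "nc_eval scale (\<rho>(p := 0)) c = 0"
    using nc_eval_upd_scale[OF c, of \<rho> 0 0] by simp
  then have "subspace {x. nc_eval scale (\<rho>(p := x)) c = 0}"
    by (intro subspaceI) (simp_all add: nc_eval_upd_add[OF c] nc_eval_upd_scale[OF c] del: fun_upd_apply)
  then have "span W \<subseteq> {x. nc_eval scale (\<rho>(p := x)) c = 0}"
    using W by (intro span_minimal) auto
  then show ?thesis using x by blast
qed

lemma multilinear_zero_of_spanning: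
  assumes c: "multilinear n c" and W: "span W = UNIV"
    and zero: "\<And>\<rho>. \<forall>p\<in>{1..n}. \<rho> p \<in> W \<Longrightarrow> nc_eval scale \<rho> c = 0"
  shows "nc_eval scale \<rho> c = 0"
proof -
  \<comment> \<open>Variables are freed one at a time: the first \<open>k\<close> take arbitrary
    values, the others values in \<open>W\<close>. The case \<open>k = 0\<close> is the hypothesis,
    and \<open>k = n\<close> is the claim.\<close>
  have "nc_eval scale \<rho> c = 0" if "k \<le> n" "\<forall>p\<in>{k<..n}. \<rho> p \<in> W" for k \<rho>
    using that
  proof (induction k arbitrary: \<rho>)
    case 0
    then show ?case by (intro zero) (auto simp: Suc_le_eq)
  next
    case (Suc k)
    have IH: "nc_eval scale (\<rho>(Suc k := a)) c = 0" if "a \<in> W" for a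
      using Suc.prems that by (intro Suc.IH) (auto simp: less_Suc_eq_le Suc_le_eq)
    \<comment> \<open>The trivial update exposes the variable \<open>Suc k\<close>; its value lies
      in \<open>span W\<close>, and the induction hypothesis covers the values in
      \<open>W\<close>.\<close>
    have "nc_eval scale (\<rho>(Suc k := \<rho> (Suc k))) c = 0"
      by (rule nc_eval_upd_zero_on_span[OF c _ IH]) (use Suc.prems(1) W in auto)
    then show ?case by simp
  qed
  from this[of n \<rho>] show ?thesis by simp
qed

lemma span_mult_left:
  assumes "\<And>y. y \<in> A \<Longrightarrow> x * y \<in> span B" "y \<in> span A"
  shows "x * y \<in> span B"
  using assms(2)
proof (induction rule: span_induct)
  case base
  show ?case
    by (auto simp: subspace_def distrib_left scale_mult_right intro: span_zero span_add span_scale)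
qed (rule assms(1))

lemma span_mult_right:
  assumes "\<And>x. x \<in> A \<Longrightarrow> x * y \<in> span B" "x \<in> span A"
  shows "x * y \<in> span B"
  using assms(2)
proof (induction rule: span_induct)
  case base
  show ?case
    by (auto simp: subspace_def distrib_right scale_mult_left intro: span_zero span_add span_scale)
qed (rule assms(1))

lemma span_words_upto_stable:
  assumes gen: "generates scale (span U)" and k: "1 \<le> k"
    and stable: "span (words_upto U (Suc k)) = span (words_upto U k)"
  shows "span (words_upto U k) = UNIV"
proof -
  let ?S = "span (words_upto U k)"
  \<comment> \<open>Closure under products comes in three stages: a letter times \<open>?S\<close>,
    where prepending may give length \<open>Suc k\<close> and stability is used; a word times
    \<open>?S\<close>, absorbing its letters one by one; and \<open>?S\<close> times
    \<open>?S\<close>, by linearity.\<close>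
  have letter: "x * y \<in> ?S" if "x \<in> U" "y \<in> ?S" for x y
  proof (rule span_mult_left[OF _ that(2)])
    fix y assume "y \<in> words_upto U k"
    then obtain ys where ys: "y = word_prod ys" "set ys \<subseteq> U" "1 \<le> length ys" "length ys \<le> k"
      by (auto simp: words_upto_def)
    then have "x * y = word_prod (x # ys)" by (subst word_prod_Cons) auto
    then have "x * y \<in> words_upto U (Suc k)"
      using ys that(1) unfolding words_upto_def by (intro image_eqI[where x = "x # ys"]) auto
    then show "x * y \<in> ?S" using stable span_base by blast
  qed
  have word: "word_prod xs * y \<in> ?S" if "set xs \<subseteq> U" "xs \<noteq> []" "y \<in> ?S" for xs y
    using that(2,1)
    by (induction xs rule: list_nonempty_induct)
      (auto simp: word_prod_Cons mult.assoc that(3) intro: letter)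
  have "x * y \<in> ?S" if "x \<in> ?S" "y \<in> ?S" for x y
  proof (rule span_mult_right[OF _ that(1)])
    fix x assume "x \<in> words_upto U k"
    then obtain xs where "x = word_prod xs" "set xs \<subseteq> U" "xs \<noteq> []"
      by (force simp: words_upto_def)
    then show "x * y \<in> ?S" using word that(2) by simp
  qed
  then have "subalgebra scale ?S" by (simp add: subalgebra_def subspace_span)
  moreover have "span U \<subseteq> ?S"
    using words_upto_mono[OF k, of U] by (intro span_mono) (simp add: words_upto_one)
  ultimately have "subalgebra scale hull span U \<subseteq> ?S" by (intro hull_minimal)
  then show ?thesis using gen by (auto simp: generates_def)
qed

end

section \<open>The bound on the word length\<close>

lemma (in fd_assoc_algebra) span_words_upto_eq_UNIV:
  assumes gen: "generates scale (span U)"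
  shows "span (words_upto U (dim UNIV - dim (span U) + 1)) = UNIV"
proof -
  obtain B where B: "finite B" "span B = UNIV" using finite_dim by blast
  obtain B' where B': "B' \<subseteq> B" "independent B'" "span B' = UNIV"
    using maximal_independent_subset[of B] B(2) by (metis span_mono span_span top.extremum_uniqueI)
  interpret fd: finite_dimensional_vector_space scale B'
    using B B' by unfold_locales (auto intro: finite_subset)
  \<comment> \<open>The index is shifted by one because the count starts at length 1, where the span
    is \<open>span U\<close> itself. Each further step is stable, hence already everything, or a
    strict inclusion that raises the dimension.\<close>
  have grow: "span (words_upto U (Suc k)) = UNIV \<or>
      dim (span U) + k \<le> dim (span (words_upto U (Suc k)))" for k
  proof (induction k)
    case 0
    show ?case using words_upto_one[of U] by simp
  next
    case (Suc k)
    have sub: "span (words_upto U (Suc k)) \<subseteq> span (words_upto U (Suc (Suc k)))"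
      by (intro span_mono words_upto_mono) simp
    show ?case
    proof (cases "span (words_upto U (Suc (Suc k))) = span (words_upto U (Suc k))")
      case True
      then show ?thesis using span_words_upto_stable[OF gen, of "Suc k"] by simp
    next
      case False
      with sub have "dim (span (words_upto U (Suc k))) < dim (span (words_upto U (Suc (Suc k))))"
        by (intro fd.dim_psubset) (auto simp: span_span)
      with Suc sub show ?thesis by auto
    qed
  qed
  \<comment> \<open>Ensures that the subtraction on naturals is not truncated, so the lower bound in
    \<open>grow\<close> becomes \<open>dim UNIV\<close>.\<close>
  have "dim (span U) \<le> dim UNIV" by (rule fd.dim_subset) simp
  with grow[of "dim UNIV - dim (span U)"] consider
      "span (words_upto U (dim UNIV - dim (span U) + 1)) = UNIV"
    | "dim UNIV \<le> dim (span (words_upto U (dim UNIV - dim (span U) + 1)))"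
    by (metis Suc_eq_plus1 le_add_diff_inverse)
  then show ?thesis
  proof cases
    case 2
    then show ?thesis
      by (intro fd.subspace_dim_equal) (simp_all add: subspace_span del: fd.dim_UNIV dim_span)
  qed
qed

section \<open>Finding a nonzero value on words, and passing to the pair\<close>

theorem mainTheorem3:
  fixes scale :: "'f::field \<Rightarrow> 'r::ring \<Rightarrow> 'r"
    and V :: "'r set"
    and u :: "nat \<Rightarrow> 'r"
    and c :: "(nat, 'f) nc_poly"
    and d m n :: nat
  assumes algebra: "fd_assoc_algebra scale"
    and center: "(center :: 'r set) \<noteq> {0}"
    and V_subspace: "module.subspace scale V"
    and V_generates: "generates scale V"
    and dim_R: "vector_space.dim scale (UNIV :: 'r set) = d"
    and dim_V: "vector_space.dim scale V = m"
    and c_multilinear: "multilinear n c"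
    and c_central: "central_poly scale c"
    and U_indexed: "inj_on u {1..m}"
    and U_independent: "\<not> module.dependent scale (u ` {1..m})"
    and U_span: "module.span scale (u ` {1..m}) = V"
  shows "(\<exists>h. (\<forall>p\<in>{1..n}. 1 \<le> h p \<and> h p \<le> d - m + 1) \<and> nonzero_on_words scale u m n c h) \<and>
         (\<forall>h. (\<forall>p\<in>{1..n}. 1 \<le> h p \<and> h p \<le> d - m + 1) \<longrightarrow> nonzero_on_words scale u m n c h \<longrightarrow>
              pair_central_poly scale V (word_subst c h))"
proof -
  interpret fd_assoc_algebra scale by (rule algebra)
  have c_free: "c \<in> free_algebra" using c_central by (simp add: pair_central_poly_def)
  show ?thesis
  proof (intro conjI allI impI)
    let ?W = "words_upto (u ` {1..m}) (d - m + 1)"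
    obtain \<rho>\<^sub>0 where "nc_eval scale \<rho>\<^sub>0 c \<noteq> 0"
      using c_central by (auto simp: pair_central_poly_def pair_identity_def)
    moreover have "span ?W = UNIV"
      using V_generates by (rule span_words_upto_eq_UNIV[of "u ` {1..m}", unfolded U_span dim_R dim_V])
    ultimately obtain \<rho> where \<rho>: "\<forall>p\<in>{1..n}. \<rho> p \<in> ?W" "nc_eval scale \<rho> c \<noteq> 0"
      using multilinear_zero_of_spanning[OF c_multilinear] by metis
    have "\<forall>p\<in>{1..n}. \<exists>ks. set ks \<subseteq> {1..m} \<and> 1 \<le> length ks \<and> length ks \<le> d - m + 1 \<and>
        \<rho> p = word_prod (map u ks)"
    proof
      fix p assume "p \<in> {1..n}"
      with \<rho>(1) obtain xs where xs: "xs \<in> lists (u ` {1..m})" "1 \<le> length xs" "length xs \<le> d - m + 1"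
          "\<rho> p = word_prod xs"
        by (fastforce simp: words_upto_def)
      then show "\<exists>ks. set ks \<subseteq> {1..m} \<and> 1 \<le> length ks \<and> length ks \<le> d - m + 1 \<and>
          \<rho> p = word_prod (map u ks)"
        unfolding lists_image by auto
    qed
    then obtain ks where ks: "\<And>p. p \<in> {1..n} \<Longrightarrow> set (ks p) \<subseteq> {1..m} \<and> 1 \<le> length (ks p) \<and>
        length (ks p) \<le> d - m + 1 \<and> \<rho> p = word_prod (map u (ks p))"
      by metis
    \<comment> \<open>Letter positions \<open>j\<close> count from 1, list positions from 0.\<close>
    have shift: "map (\<lambda>j. u (ks p ! (j - 1))) [1..<length (ks p) + 1] = map u (ks p)" for p
      by (rule nth_equalityI) (auto simp del: upt_Suc)
    have "nc_eval scale (\<lambda>p. word_prod (map (\<lambda>j. u (ks p ! (j - 1))) [1..<length (ks p) + 1])) c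
        = nc_eval scale \<rho> c"
      unfolding shift using ks by (intro multilinear_nc_eval_cong[OF c_multilinear]) simp
    moreover have "ks p ! (j - 1) \<in> {1..m}" if "p \<in> {1..n}" "j \<in> {1..length (ks p)}" for p j
      using ks[OF that(1)] that(2) by (auto dest!: subsetD[OF _ nth_mem[of "j - 1"]])
    ultimately have "nonzero_on_words scale u m n c (\<lambda>p. length (ks p))"
      unfolding nonzero_on_words_def using \<rho>(2)
      by (intro exI[of _ "\<lambda>p j. ks p ! (j - 1)"]) auto
    then show "\<exists>h. (\<forall>p\<in>{1..n}. 1 \<le> h p \<and> h p \<le> d - m + 1) \<and> nonzero_on_words scale u m n c h"
      using ks by (intro exI[of _ "\<lambda>p. length (ks p)"]) auto
  next
    fix h :: "nat \<Rightarrow> nat"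
    assume "\<forall>p\<in>{1..n}. 1 \<le> h p \<and> h p \<le> d - m + 1" and nonzero: "nonzero_on_words scale u m n c h"
    then have h: "\<forall>p\<in>{1..n}. 1 \<le> h p" by simp
    note eval = nc_eval_word_subst[OF c_multilinear c_free h]
    obtain i where i: "\<forall>p\<in>{1..n}. \<forall>j\<in>{1..h p}. i p j \<in> {1..m}"
        "nc_eval scale (\<lambda>p. word_prod (map (\<lambda>j. u (i p j)) [1..<h p + 1])) c \<noteq> 0"
      using nonzero by (auto simp: nonzero_on_words_def)
    \<comment> \<open>The witness against being an identity must send every variable into
      \<open>V\<close>; variables outside the blocks get 0, which lies in the subspace
      \<open>V\<close>.\<close>
    define v where "v = (\<lambda>(p, j). if p \<in> {1..n} \<and> j \<in> {1..h p} then u (i p j) else 0)"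
    have "v x \<in> V" for x
      using i(1) subspace_0[OF V_subspace] U_span span_base[of _ "u ` {1..m}"]
      by (auto simp: v_def split: prod.splits)
    moreover have "nc_eval scale v (word_subst c h)
        = nc_eval scale (\<lambda>p. word_prod (map (\<lambda>j. u (i p j)) [1..<h p + 1])) c"
      unfolding eval
      by (intro multilinear_nc_eval_cong[OF c_multilinear] arg_cong[where f = word_prod] map_cong refl)
        (auto simp: v_def simp del: upt_Suc)
    ultimately have "\<not> pair_identity scale V (word_subst c h)"
      using i(2) by (metis pair_identity_def)
    then show "pair_central_poly scale V (word_subst c h)"
      using c_central word_subst_in_free_algebra[OF c_multilinear c_free h]
      by (simp add: pair_central_poly_def eval)
  qed
qed

end
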